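(* Let $\mathcal{X}\subseteq\{0,1\}^n$ be a nonempty set of feasible solutions and $\mathcal{U}=\times_{i=1}^n[\underline{c}_i,\overline{c}_i]$ with $\underline{c}_i\le\overline{c}_i$ real. For $x\in\mathcal{X}$, $c\in\mathcal{U}$ let $Reg(x,c)=\sum_ic_ix_i-\min_{y\in\mathcal{X}}\sum_ic_iy_i$. Consider the zero-sum two-player game in which the $x$-player chooses $x\in\mathcal{X}$ (and wants to minimize the payoff), the $c$-player chooses $c\in\mathcal{U}$ (and wants to maximize it), and the payoff is $Reg(x,c)$; mixed strategies are finitely supported probability distributions $P_{\mathcal{X}}$ on $\mathcal{X}$ and $P_{\mathcal{U}}$ on $\mathcal{U}$, with $Reg(P_{\mathcal{X}},P_{\mathcal{U}})=\sum_x\sum_cP_{\mathcal{X}}(x)P_{\mathcal{U}}(c)Reg(x,c)$. Then this game has a (possibly mixed) Nash equilibrium: there exist finitely supported $P^*_{\mathcal{X}}$, $P^*_{\mathcal{U}}$ such that $Reg(P^*_{\mathcal{X}},P_{\mathcal{U}})\le Reg(P^*_{\mathcal{X}},P^*_{\mathcal{U}})\le Reg(P_{\mathcal{X}},P^*_{\mathcal{U}})$ for all finitely supported $P_{\mathcal{X}}$ on $\mathcal{X}$ and $P_{\mathcal{U}}$ on $\mathcal{U}$. *)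

theory Defs
  imports "HOL-Analysis.Analysis" "HOL-Probability.Probability_Mass_Function"
begin

definition zero_one_vectors :: "(real ^ 'n) set" where
  "zero_one_vectors = {x. \<forall>i. x $ i = 0 \<or> x $ i = 1}"

definition cost :: "real ^ 'n \<Rightarrow> real ^ 'n \<Rightarrow> real" where
  "cost c x = (\<Sum>i\<in>UNIV. c $ i * x $ i)"

(* Min is the true minimum only on a finite nonempty set; it is applied below only to
   nonempty X contained in the (finite) set zero_one_vectors. *)
definition regret :: "(real ^ 'n) set \<Rightarrow> real ^ 'n \<Rightarrow> real ^ 'n \<Rightarrow> real" where
  "regret X x c = cost c x - Min ((\<lambda>y. cost c y) ` X)"

definition mixed_strategies :: "'a set \<Rightarrow> 'a pmf set" where
  "mixed_strategies S = {P. finite (set_pmf P) \<and> set_pmf P \<subseteq> S}"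

definition expected_regret ::
  "(real ^ 'n) set \<Rightarrow> (real ^ 'n) pmf \<Rightarrow> (real ^ 'n) pmf \<Rightarrow> real" where
  "expected_regret X P Q =
     (\<Sum>x\<in>set_pmf P. \<Sum>c\<in>set_pmf Q. pmf P x * pmf Q c * regret X x c)"

end

(* Consider the compact set K of regret vectors (Reg(x,c))_x as c ranges over the box. On the convex
   hull of K the smallest coordinate attains its maximum V, at a point that is a finite mixture Q' of
   box points. The hull is disjoint from the open convex set of vectors all of whose coordinates
   exceed V, and the normal vector of a separating hyperplane, which is nonnegative and can be
   normalised to total mass 1, is a mixed strategy P' guaranteeing the x-player at most V. *)
theory Submission
  imports Defs
begin

lemma continuous_on_Min_image:
  fixes f :: "'a \<Rightarrow> 'b::topological_space \<Rightarrow> real"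
  assumes "finite A" "A \<noteq> {}" "\<And>a. a \<in> A \<Longrightarrow> continuous_on S (f a)"
  shows "continuous_on S (\<lambda>x. Min ((\<lambda>a. f a x) ` A))"
  using assms
proof (induction A rule: finite_ne_induct)
  case (insert a F)
  have "continuous_on S (\<lambda>x. min (f a x) (Min ((\<lambda>a. f a x) ` F)))"
    using insert by (intro continuous_on_min) auto
  then show ?case
    using insert by simp
qed simp

text \<open>Turns the coefficients of a convex combination, and later a normalised normal vector,
  into mixed strategies.\<close>

lemma pmf_of_finite_weights:
  fixes u :: "'a \<Rightarrow> real"
  assumes "finite S" "\<And>x. x \<in> S \<Longrightarrow> 0 \<le> u x" "sum u S = 1"
  obtains p where "set_pmf p \<subseteq> S" "\<And>x. x \<in> S \<Longrightarrow> pmf p x = u x"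
proof -
  \<comment> \<open>\<open>embed_pmf\<close> takes weights on the whole type, so \<open>u\<close> is
    extended by zero outside \<open>S\<close>.\<close>
  define w where "w x = (if x \<in> S then u x else 0)" for x
  have nonneg: "0 \<le> w x" for x
    using assms(2) by (simp add: w_def)
  have "(\<integral>\<^sup>+ x. ennreal (w x) \<partial>count_space UNIV) = (\<Sum>x\<in>S. ennreal (w x))"
    using assms(1) by (intro nn_integral_count_space') (auto simp: w_def)
  also have "\<dots> = ennreal (sum w S)"
    using nonneg by (intro sum_ennreal) auto
  also have "sum w S = 1"
    using assms(3) by (simp add: w_def)
  finally have total: "(\<integral>\<^sup>+ x. ennreal (w x) \<partial>count_space UNIV) = 1"
    by simp
  have pmf: "pmf (embed_pmf w) x = w x" for x
    using nonneg total by (rule pmf_embed_pmf)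
  show thesis
  proof
    show "set_pmf (embed_pmf w) \<subseteq> S"
      using pmf by (auto simp: set_pmf_iff w_def split: if_splits)
  qed (use pmf in \<open>simp add: w_def\<close>)
qed

lemma expectation_finite_support:
  fixes f :: "'a \<Rightarrow> real"
  assumes "finite (set_pmf p)"
  shows "measure_pmf.expectation p f = (\<Sum>x\<in>set_pmf p. pmf p x * f x)"
  using integral_measure_pmf_real[OF assms, of p f] by (simp add: mult.commute)

lemma expectation_ge:
  fixes f :: "'a \<Rightarrow> real"
  assumes "finite (set_pmf p)" "\<And>x. x \<in> set_pmf p \<Longrightarrow> V \<le> f x"
  shows "V \<le> measure_pmf.expectation p f"
proof -
  have "V = (\<Sum>x\<in>set_pmf p. pmf p x * V)"
    using sum_pmf_eq_1[OF assms(1), of p] by (simp flip: sum_distrib_right)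
  also have "\<dots> \<le> (\<Sum>x\<in>set_pmf p. pmf p x * f x)"
    using assms(2) by (intro sum_mono mult_left_mono) auto
  finally show ?thesis
    using assms(1) by (simp add: expectation_finite_support)
qed

lemma expectation_le:
  fixes f :: "'a \<Rightarrow> real"
  assumes "finite (set_pmf p)" "\<And>x. x \<in> set_pmf p \<Longrightarrow> f x \<le> V"
  shows "measure_pmf.expectation p f \<le> V"
  using expectation_ge[of p "- V" "\<lambda>x. - f x"] assms by simp

text \<open>Finite mixtures over \<open>S\<close> realise every point of the convex hull of the
  payoff vectors, so this hull can be separated from an orthant. Both players guarantee the same
  \<open>V\<close>, which makes \<open>p\<close> and \<open>Q\<close> a saddle point. The finite
  index type places payoff vectors in \<open>real ^ 'k\<close>.\<close>

lemma minimax_finite_compact: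
  fixes f :: "'k::finite \<Rightarrow> 'b::topological_space \<Rightarrow> real"
  assumes "compact S" "S \<noteq> {}" "\<And>k. continuous_on S (f k)"
  obtains p Q V where "finite (set_pmf Q)" "set_pmf Q \<subseteq> S"
    "\<And>k. V \<le> measure_pmf.expectation Q (f k)"
    "\<And>c. c \<in> S \<Longrightarrow> measure_pmf.expectation p (\<lambda>k. f k c) \<le> V"
proof -
  define v where "v c = (\<chi> k. f k c)" for c
  define K where "K = convex hull (v ` S)"
  define m :: "real ^ 'k \<Rightarrow> real" where "m z = Min (range (\<lambda>k. z $ k))" for z
  have "continuous_on S v"
    unfolding v_def by (intro continuous_on_vec_lambda assms)
  then have "compact K"
    unfolding K_def using assms(1) by (intro compact_convex_hull compact_continuous_image)
  moreover have "K \<noteq> {}"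
    using assms(2) by (simp add: K_def)
  moreover have "continuous_on K m"
    unfolding m_def by (intro continuous_on_Min_image continuous_intros) auto
  ultimately obtain z where z: "z \<in> K" and max: "\<And>y. y \<in> K \<Longrightarrow> m y \<le> m z"
    using continuous_attains_sup[of K m] by metis
  define V where "V = m z"

  obtain T u where T: "finite T" "T \<subseteq> v ` S" "\<And>x. x \<in> T \<Longrightarrow> 0 \<le> u x" "sum u T = 1"
      and z_eq: "(\<Sum>x\<in>T. u x *\<^sub>R x) = z"
    using z unfolding K_def convex_hull_explicit by blast
  obtain q where q: "set_pmf q \<subseteq> T" "\<And>x. x \<in> T \<Longrightarrow> pmf q x = u x"
    using pmf_of_finite_weights[OF T(1,3,4)] by blast
  have q_fin: "finite (set_pmf q)"
    using q(1) T(1) by (rule finite_subset)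
  \<comment> \<open>\<open>q\<close> lives on payoff vectors; choosing one preimage in
    \<open>S\<close> for each of them carries it over to \<open>S\<close> with the same expected
    payoffs.\<close>
  define h where "h = inv_into S v"
  have h: "h x \<in> S" "v (h x) = x" if "x \<in> T" for x
    using that T(2) by (auto simp: h_def inv_into_into f_inv_into_f subset_iff)
  define Q where "Q = map_pmf h q"
  have Q_exp: "measure_pmf.expectation Q (f k) = z $ k" for k
  proof -
    have "measure_pmf.expectation Q (f k) = (\<Sum>x\<in>T. f k (h x) * pmf q x)"
      unfolding Q_def integral_map_pmf using q(1)
      by (intro integral_measure_pmf_real[OF T(1)]) auto
    also have "\<dots> = (\<Sum>x\<in>T. u x * x $ k)"
      using h(2) q(2) by (intro sum.cong) (auto simp: v_def vec_eq_iff mult.commute)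
    finally show ?thesis
      by (simp flip: z_eq)
  qed

  define W where "W = {w :: real ^ 'k. \<forall>k. V < w $ k}"
  have "W = (\<Inter>k. {w. V < w $ k})"
    by (auto simp: W_def)
  moreover have "convex {w :: real ^ 'k. V < w $ k}" for k
    using convex_halfspace_gt[of V "axis k (1::real)"] by (simp add: inner_axis')
  ultimately have "convex W"
    by (simp add: convex_INT)
  moreover have "K \<inter> W = {}"
  proof -
    have "V < m w" if "w \<in> W" for w
      using that by (simp add: m_def W_def)
    then show ?thesis
      using max by (fastforce simp: V_def)
  qed
  \<comment> \<open>Moving arbitrarily far along a coordinate direction stays inside
    \<open>W\<close>; besides showing that \<open>W\<close> is nonempty, this forces the sign of
    each coordinate of \<open>a\<close>.\<close>
  moreover have W_mem: "(\<chi> k. V + 1) + axis j t \<in> W" if "0 \<le> t" for t j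
    using that by (simp add: W_def axis_def)
  then have "W \<noteq> {}"
    by blast
  ultimately obtain a b where a: "a \<noteq> 0"
      and aK: "\<And>y. y \<in> K \<Longrightarrow> a \<bullet> y \<le> b" and aW: "\<And>w. w \<in> W \<Longrightarrow> b \<le> a \<bullet> w"
    using separating_hyperplane_sets[of K W] \<open>K \<noteq> {}\<close> convex_convex_hull[of "v ` S"]
    unfolding K_def by metis
  define s where "s = (\<Sum>k\<in>UNIV. a $ k)"
  have a_nonneg: "0 \<le> a $ j" for j
  proof (rule ccontr)
    assume neg: "\<not> 0 \<le> a $ j"
    \<comment> \<open>Chosen so that the shifted point has inner product
      \<open>s * (V + 1) - \<bar>s * (V + 1) - b\<bar> - 1\<close> with \<open>a\<close>, which is
      below \<open>b\<close>.\<close>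
    define t where "t = (\<bar>s * (V + 1) - b\<bar> + 1) / (- a $ j)"
    have "0 \<le> t"
      using neg by (simp add: t_def divide_nonneg_neg)
    then have "b \<le> a \<bullet> ((\<chi> k. V + 1) + axis j t)"
      by (intro aW W_mem)
    also have "\<dots> = s * (V + 1) + a $ j * t"
      by (simp add: inner_add_right inner_axis) (simp add: inner_vec_def s_def sum_distrib_right)
    also have "a $ j * t = - (\<bar>s * (V + 1) - b\<bar> + 1)"
      using neg by (simp add: t_def)
    finally show False
      by linarith
  qed
  have "s \<noteq> 0"
    using a a_nonneg by (auto simp: s_def sum_nonneg_eq_0_iff vec_eq_iff)
  then have s_pos: "0 < s"
    using a_nonneg by (simp add: s_def sum_nonneg less_le)
  \<comment> \<open>The corner with all coordinates \<open>V\<close> lies outside \<open>W\<close>,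
    so it is approached by the constant vectors \<open>V + e / s\<close>; the division by
    \<open>s\<close> makes the error exactly \<open>e\<close>.\<close>
  have b_le: "b \<le> s * V"
  proof (rule field_le_epsilon)
    fix e :: real assume "0 < e"
    then have "(\<chi> k. V + e / s) \<in> W"
      using s_pos by (simp add: W_def)
    then have "b \<le> a \<bullet> (\<chi> k. V + e / s)"
      by (rule aW)
    also have "\<dots> = s * (V + e / s)"
      by (simp add: inner_vec_def s_def sum_distrib_right)
    finally show "b \<le> s * V + e"
      using s_pos by (simp add: algebra_simps)
  qed

  obtain p where p: "\<And>k. pmf p k = a $ k / s"
    using pmf_of_finite_weights[of UNIV "\<lambda>k. a $ k / s"] a_nonneg s_pos
    by (auto simp flip: sum_divide_distrib simp: s_def)
  \<comment> \<open>After division by \<open>s\<close>, the separation on the side of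
    \<open>K\<close> bounds the payoff by \<open>b / s\<close>, hence by \<open>V\<close>.\<close>
  have p_le: "measure_pmf.expectation p (\<lambda>k. f k c) \<le> V" if "c \<in> S" for c
  proof -
    have "measure_pmf.expectation p (\<lambda>k. f k c) = (a \<bullet> v c) / s"
      by (subst integral_measure_pmf_real[of UNIV])
        (auto simp: p inner_vec_def v_def sum_divide_distrib mult.commute)
    also have "a \<bullet> v c \<le> s * V"
      using aK[of "v c"] b_le that by (fastforce simp: K_def intro: hull_inc)
    finally show ?thesis
      using s_pos by (simp add: field_simps)
  qed

  show thesis
  proof
    show "finite (set_pmf Q)" "set_pmf Q \<subseteq> S"
      using q_fin q(1) h(1) by (auto simp: Q_def)
    show "V \<le> measure_pmf.expectation Q (f k)" for k
      by (simp add: Q_exp V_def m_def)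
  qed (rule p_le)
qed

text \<open>Encoding such vectors by their supports gives both their finiteness and the enumeration
  of \<open>X\<close> by the finite type \<open>'n set\<close>.\<close>

lemma zero_one_vector_eq_indicator:
  assumes "x \<in> zero_one_vectors"
  shows "x = (\<chi> i. of_bool (i \<in> {i. x $ i = 1}))"
  using assms by (auto simp: zero_one_vectors_def vec_eq_iff)

lemma finite_zero_one_vectors: "finite (zero_one_vectors :: (real ^ 'n) set)"
proof (rule finite_surj[of UNIV])
  show "zero_one_vectors \<subseteq> range (\<lambda>A :: 'n set. (\<chi> i. of_bool (i \<in> A)) :: real ^ 'n)"
    using zero_one_vector_eq_indicator by blast
qed simp

lemma continuous_on_regret:
  assumes "finite X" "X \<noteq> {}"
  shows "continuous_on S (regret X x)"
  unfolding regret_def cost_def using assms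
  by (intro continuous_intros continuous_on_Min_image) auto

text \<open>With \<open>P\<close> outermost, a bound for \<open>Q\<close> against each pure
  \<open>x\<close> passes to every mixture \<open>P\<close>.\<close>

lemma expected_regret_eq:
  assumes "finite (set_pmf P)" "finite (set_pmf Q)"
  shows "expected_regret X P Q =
    measure_pmf.expectation P (\<lambda>x. measure_pmf.expectation Q (regret X x))"
  using assms
  by (simp add: expected_regret_def expectation_finite_support sum_distrib_left mult.assoc)

text \<open>The opposite order of summation, for bounding the payoff of \<open>P\<close> against
  each pure \<open>c\<close>.\<close>

lemma expected_regret_eq':
  assumes "finite (set_pmf P)" "finite (set_pmf Q)"
  shows "expected_regret X P Q =
    measure_pmf.expectation Q (\<lambda>c. measure_pmf.expectation P (\<lambda>x. regret X x c))"
  unfolding expected_regret_def using assms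
  by (subst sum.swap)
    (simp add: expectation_finite_support sum_distrib_left mult.assoc mult.left_commute)

theorem theorem1:
  fixes X :: "(real ^ 'n) set"
    and cl cu :: "real ^ 'n"
  assumes "X \<noteq> {}"
    and "X \<subseteq> zero_one_vectors"
    and "\<forall>i. cl $ i \<le> cu $ i"
  shows "\<exists>P' \<in> mixed_strategies X. \<exists>Q' \<in> mixed_strategies (cbox cl cu).
           (\<forall>Q \<in> mixed_strategies (cbox cl cu).
              expected_regret X P' Q \<le> expected_regret X P' Q') \<and>
           (\<forall>P \<in> mixed_strategies X.
              expected_regret X P' Q' \<le> expected_regret X P Q')"
proof -
  have X_fin: "finite X"
    using assms(2) finite_zero_one_vectors by (rule finite_subset)
  (* Enumerate X, with repetitions, by a finite type, so that regret vectors live in a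
     Euclidean space. *)
  obtain x0 where "x0 \<in> X"
    using assms(1) by blast
  define g :: "'n set \<Rightarrow> real ^ 'n" where
    "g A = (let x = \<chi> i. of_bool (i \<in> A) in if x \<in> X then x else x0)" for A
  have g_mem: "g A \<in> X" for A
    using \<open>x0 \<in> X\<close> by (simp add: g_def Let_def)
  have g_onto: "\<exists>A. x = g A" if "x \<in> X" for x
  proof -
    have "x = (\<chi> i. of_bool (i \<in> {i. x $ i = 1}))"
      using that assms(2) zero_one_vector_eq_indicator by blast
    then have "x = g {i. x $ i = 1}"
      using that by (simp add: g_def Let_def)
    then show ?thesis ..
  qed
  have "cbox cl cu \<noteq> {}"
    using assms(3) by (simp add: interval_ne_empty_cart)
  then obtain p Q' V where Q': "finite (set_pmf Q')" "set_pmf Q' \<subseteq> cbox cl cu"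
      and lower: "\<And>A. V \<le> measure_pmf.expectation Q' (regret X (g A))"
      and upper: "\<And>c. c \<in> cbox cl cu \<Longrightarrow>
        measure_pmf.expectation p (\<lambda>A. regret X (g A) c) \<le> V"
    using minimax_finite_compact[of "cbox cl cu" "\<lambda>A. regret X (g A)"]
      continuous_on_regret[OF X_fin assms(1)] compact_cbox by metis
  \<comment> \<open>The push-forward adds up the weights of all index sets that \<open>g\<close>
    sends to the same vector.\<close>
  define P' where "P' = map_pmf g p"
  have P'_fin: "finite (set_pmf P')"
    by (simp add: P'_def)
  have P'_mem: "P' \<in> mixed_strategies X"
    using g_mem by (auto simp: mixed_strategies_def P'_def)
  have Q'_mem: "Q' \<in> mixed_strategies (cbox cl cu)"
    using Q' by (simp add: mixed_strategies_def)
  have P'_le: "expected_regret X P' Q \<le> V" if "Q \<in> mixed_strategies (cbox cl cu)" for Q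
  proof -
    have Q: "finite (set_pmf Q)" "set_pmf Q \<subseteq> cbox cl cu"
      using that by (auto simp: mixed_strategies_def)
    have "measure_pmf.expectation P' (\<lambda>x. regret X x c) \<le> V" if "c \<in> set_pmf Q" for c
      using upper[of c] that Q(2) by (auto simp: P'_def)
    then show ?thesis
      unfolding expected_regret_eq'[OF P'_fin Q(1)] by (rule expectation_le[OF Q(1)])
  qed
  have Q'_ge: "V \<le> expected_regret X P Q'" if "P \<in> mixed_strategies X" for P
  proof -
    have P: "finite (set_pmf P)" "set_pmf P \<subseteq> X"
      using that by (auto simp: mixed_strategies_def)
    \<comment> \<open>\<open>lower\<close> covers only the vectors \<open>g A\<close>; since
      \<open>g\<close> is onto \<open>X\<close>, these include every pure strategy in the support of
      \<open>P\<close>.\<close>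
    have "V \<le> measure_pmf.expectation Q' (regret X x)" if "x \<in> set_pmf P" for x
      using g_onto[of x] lower that P(2) by auto
    then show ?thesis
      unfolding expected_regret_eq[OF P(1) Q'(1)] by (rule expectation_ge[OF P(1)])
  qed
  \<comment> \<open>Pairing the two guarantees with each other identifies \<open>V\<close> as the
    equilibrium payoff, so the guarantees become the two equilibrium inequalities.\<close>
  have "expected_regret X P' Q' = V"
    using P'_le[OF Q'_mem] Q'_ge[OF P'_mem] by (rule antisym)
  then show ?thesis
    using P'_mem Q'_mem P'_le Q'_ge by metis
qed

end
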